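(* Let $f\colon S\to S^3$ be a non-conformal harmonic map from a Riemann surface $S$ into the 3-sphere, with adapted complex coordinate $z$, and let $f^+$ and $f^-$ be its $(+)$transform and $(-)$transform. Then $f^+$ and $f^-$ are also non-conformal harmonic maps from $S$ to $S^3$. Furthermore, the adapted complex coordinate $z$ for $f$ is also an adapted complex coordinate for $f^+$ and for $f^-$, i.e. $\langle \partial f^{\pm},\partial f^{\pm}\rangle=-1$.
   Context: Identify $\mathbb{R}^4$ with the quaternions $\mathbb{H}$ (basis $1,e_1,e_2,e_3$ with $e_1^2=e_2^2=e_3^2=e_1e_2e_3=-1$), $\mathbb{R}^3$ with the imaginary quaternions $\operatorname{Im}\mathbb{H}$, and $S^3$ with the unit quaternions. $\langle\,,\rangle$ and $\times$ denote the Euclidean inner product and the vector product of $\mathbb{R}^3$, extended complex-bilinearly to complexified vectors. For a complex coordinate $z=x+iy$ write $\partial=\partial/\partial z$, $\bar\partial=\partial/\partial\bar z$. A smooth map $f\colon S\to S^3\subset\mathbb{R}^4$ is harmonic if $\partial\bar\partial f=-|\partial f|^2 f$, where $|\partial f|^2=\langle\partial f,\bar\partial f\rangle$. Then $\langle\partial f,\partial f\rangle$ is holomorphic. The map is called non-conformal if $\langle \partial f,\partial f\rangle\neq 0$; then there are complex coordinates $z$ with $\langle\partial f,\partial f\rangle=-1$, called adapted complex coordinates for $f$. Standing convention: an adapted coordinate $z=x+iy$ is fixed on $S$ (i.e. $S$ is the domain of the adapted coordinate), and it is used for all constructions. Define $\operatorname{Im}\mathbb{H}$-valued functions $\alpha,\beta$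 by $f_x=f\alpha$, $f_y=f\beta$ (quaternion product). Adaptedness gives $\langle\alpha,\beta\rangle=0$ and a non-negative function $\phi$ with $|\alpha|=2\sinh\phi$, $|\beta|=2\cosh\phi$. Where $\alpha\ne0$ (equivalently $\phi>0$) put $N=\tfrac{1}{2}\operatorname{csch}(2\phi)\, f(\alpha\times\beta)$, the unit normal. The transforms are $$f^{\pm}=\pm\tfrac{i}{2}\operatorname{sech}^2\phi\,(\partial f-\bar\partial f)+\tanh\phi\,N=\tfrac12\operatorname{sech}^2\phi\; f\bigl(\pm\beta+\tfrac12\,\alpha\times\beta\bigr).$$ Standing assumption: one works on the set where $\alpha\neq0$, i.e. $\phi>0$ on $S$ (the last expression for $f^\pm$ makes sense also where $\alpha=0$). *)

theory Defs
  imports "HOL-Analysis.Analysis"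
begin

unbundle cross3_syntax

section \<open>Quaternions as real 4-vectors\<close>

text \<open>A quaternion $a + b e_1 + c e_2 + d e_3$ is the vector with components
  $(a,b,c,d)$, so that the scalar part has index 1.\<close>

definition qmul :: "real^4 \<Rightarrow> real^4 \<Rightarrow> real^4"  (infixl \<open>\<odot>\<close> 70)
  where "p \<odot> q = vector
    [p$1 * q$1 - p$2 * q$2 - p$3 * q$3 - p$4 * q$4,
     p$1 * q$2 + p$2 * q$1 + p$3 * q$4 - p$4 * q$3,
     p$1 * q$3 - p$2 * q$4 + p$3 * q$1 + p$4 * q$2,
     p$1 * q$4 + p$2 * q$3 - p$3 * q$2 + p$4 * q$1]"

definition im :: "real^3 \<Rightarrow> real^4"
  where "im v = vector [0, v$1, v$2, v$3]"

lemma vector_4_nth [simp]: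
  "(vector [a,b,c,d] :: 'a::zero^4)$1 = a"
  "(vector [a,b,c,d] :: 'a::zero^4)$2 = b"
  "(vector [a,b,c,d] :: 'a::zero^4)$3 = c"
  "(vector [a,b,c,d] :: 'a::zero^4)$4 = d"
  by (simp_all add: vector_def)

lemma hamilton_relations:
  "axis 2 1 \<odot> axis 2 1 = - axis 1 1"
  "axis 3 1 \<odot> axis 3 1 = - axis 1 1"
  "axis 4 1 \<odot> axis 4 1 = - axis 1 1"
  "axis 2 1 \<odot> axis 3 1 \<odot> axis 4 1 = - axis 1 1"
  "axis 1 1 \<odot> p = p" "p \<odot> axis 1 1 = p"
  by (simp_all add: qmul_def vec_eq_iff forall_4 axis_def)

lemma qmul_assoc: "p \<odot> q \<odot> r = p \<odot> (q \<odot> r)"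
  by (simp add: qmul_def vec_eq_iff forall_4 algebra_simps)

lemma inner_qmul_left: "(p \<odot> q) \<bullet> (p \<odot> r) = (norm p)\<^sup>2 * (q \<bullet> r)"
  unfolding power2_norm_eq_inner
  by (simp add: qmul_def inner_vec_def sum_4 algebra_simps)

lemma inner_im [simp]: "im v \<bullet> im w = v \<bullet> w"
  by (simp add: im_def inner_vec_def sum_4 sum_3)

lemma im_cong_iff [simp]: "im v = im w \<longleftrightarrow> v = w"
  by (simp add: im_def vec_eq_iff forall_4 forall_3)

section \<open>Derivatives in the coordinate\<close>

definition pdx :: "(complex \<Rightarrow> 'v::real_normed_vector) \<Rightarrow> complex \<Rightarrow> 'v"
  where "pdx f z = frechet_derivative f (at z) 1"

definition pdy :: "(complex \<Rightarrow> 'v::real_normed_vector) \<Rightarrow> complex \<Rightarrow> 'v"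
  where "pdy f z = frechet_derivative f (at z) \<i>"

text \<open>Continuous differentiability of order \<open>k\<close> on an open set.\<close>

fun ck_on :: "nat \<Rightarrow> complex set \<Rightarrow> (complex \<Rightarrow> 'v::real_normed_vector) \<Rightarrow> bool"
  where
    "ck_on 0 S f \<longleftrightarrow> continuous_on S f"
  | "ck_on (Suc k) S f \<longleftrightarrow>
       (\<forall>z\<in>S. f differentiable (at z)) \<and> ck_on k S (pdx f) \<and> ck_on k S (pdy f)"

definition smooth_map_on :: "complex set \<Rightarrow> (complex \<Rightarrow> 'v::real_normed_vector) \<Rightarrow> bool"
  where "smooth_map_on S f \<longleftrightarrow> (\<forall>k. ck_on k S f)"

text \<open>Complexification of real vectors. The complex-bilinear extension of the inner product
  is the library's \<^const>\<open>scalar_product\<close> on complex vectors (no conjugation).\<close>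

definition cplx :: "real^'n \<Rightarrow> complex^'n"
  where "cplx v = (\<chi> i. complex_of_real (v$i))"

definition dz :: "(complex \<Rightarrow> complex^'n) \<Rightarrow> complex \<Rightarrow> complex^'n"
  where "dz F z = (1/2) *s (pdx F z - \<i> *s pdy F z)"

definition dzbar :: "(complex \<Rightarrow> complex^'n) \<Rightarrow> complex \<Rightarrow> complex^'n"
  where "dzbar F z = (1/2) *s (pdx F z + \<i> *s pdy F z)"

abbreviation del :: "(complex \<Rightarrow> real^'n) \<Rightarrow> complex \<Rightarrow> complex^'n"
  where "del f \<equiv> dz (\<lambda>w. cplx (f w))"

abbreviation delbar :: "(complex \<Rightarrow> real^'n) \<Rightarrow> complex \<Rightarrow> complex^'n"
  where "delbar f \<equiv> dzbar (\<lambda>w. cplx (f w))"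

section \<open>Non-conformal harmonic maps into the 3-sphere\<close>

text \<open>The surface is the domain of a complex coordinate and is identified by it with an
  open subset \<open>S\<close> of the plane, the coordinate being the identity.\<close>

definition harmonic_map_S3 :: "complex set \<Rightarrow> (complex \<Rightarrow> real^4) \<Rightarrow> bool"
  where "harmonic_map_S3 S f \<longleftrightarrow>
    smooth_map_on S f \<and> f ` S \<subseteq> sphere 0 1 \<and>
    (\<forall>z\<in>S. dz (delbar f) z = - scalar_product (del f z) (delbar f z) *s cplx (f z))"

definition non_conformal :: "complex set \<Rightarrow> (complex \<Rightarrow> real^4) \<Rightarrow> bool"
  where "non_conformal S f \<longleftrightarrow> (\<forall>z\<in>S. scalar_product (del f z) (del f z) \<noteq> 0)"

definition adapted_coordinate :: "complex set \<Rightarrow> (complex \<Rightarrow> real^4) \<Rightarrow> bool"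
  where "adapted_coordinate S f \<longleftrightarrow> (\<forall>z\<in>S. scalar_product (del f z) (del f z) = -1)"

section \<open>The transforms\<close>

definition alpha :: "(complex \<Rightarrow> real^4) \<Rightarrow> complex \<Rightarrow> real^3"
  where "alpha f z = (THE a. pdx f z = f z \<odot> im a)"

definition beta :: "(complex \<Rightarrow> real^4) \<Rightarrow> complex \<Rightarrow> real^3"
  where "beta f z = (THE b. pdy f z = f z \<odot> im b)"

definition phi :: "(complex \<Rightarrow> real^4) \<Rightarrow> complex \<Rightarrow> real"
  where "phi f z = (THE t. 0 \<le> t \<and> norm (alpha f z) = 2 * sinh t \<and> norm (beta f z) = 2 * cosh t)"

definition unit_normal :: "(complex \<Rightarrow> real^4) \<Rightarrow> complex \<Rightarrow> real^4"
  where "unit_normal f z =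
    (1 / (2 * sinh (2 * phi f z))) *\<^sub>R (f z \<odot> im (alpha f z \<times> beta f z))"

definition plus_transform :: "(complex \<Rightarrow> real^4) \<Rightarrow> complex \<Rightarrow> real^4"
  where "plus_transform f z =
    (1 / (2 * (cosh (phi f z))\<^sup>2)) *\<^sub>R
      (f z \<odot> im (beta f z + (1/2) *\<^sub>R (alpha f z \<times> beta f z)))"

definition minus_transform :: "(complex \<Rightarrow> real^4) \<Rightarrow> complex \<Rightarrow> real^4"
  where "minus_transform f z =
    (1 / (2 * (cosh (phi f z))\<^sup>2)) *\<^sub>R
      (f z \<odot> im (- beta f z + (1/2) *\<^sub>R (alpha f z \<times> beta f z)))"

subsection \<open>The descriptions above determine their objects\<close>

lemma tangent_eq_qmul_im:
  assumes "norm p = 1" "p \<bullet> v = 0"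
  shows "\<exists>!a. v = p \<odot> im a"
proof -
  define q :: "real^4" where "q = vector [p$1, - p$2, - p$3, - p$4]"
  have n: "p$1 * p$1 + p$2 * p$2 + p$3 * p$3 + p$4 * p$4 = 1"
    using assms(1) by (simp add: norm_eq_1 inner_vec_def sum_4)
  have qp: "q \<odot> p = axis 1 1" and pq: "p \<odot> q = axis 1 1"
    using n by (simp_all add: q_def qmul_def vec_eq_iff forall_4 axis_def algebra_simps)
  define a :: "real^3" where "a = vector [(q \<odot> v)$2, (q \<odot> v)$3, (q \<odot> v)$4]"
  have "(q \<odot> v)$1 = p \<bullet> v"
    by (simp add: q_def qmul_def inner_vec_def sum_4)
  then have "im a = q \<odot> v"
    using assms(2) by (simp add: im_def a_def vec_eq_iff forall_4)
  then have "p \<odot> im a = p \<odot> q \<odot> v"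
    by (simp only: qmul_assoc)
  then have "v = p \<odot> im a"
    by (simp add: pq hamilton_relations)
  moreover have "b = a" if "v = p \<odot> im b" for b
  proof -
    have "q \<odot> (p \<odot> im b) = q \<odot> (p \<odot> im a)"
      using that \<open>v = p \<odot> im a\<close> by simp
    then show ?thesis
      by (simp add: qmul_assoc [symmetric] qp hamilton_relations)
  qed
  ultimately show ?thesis by blast
qed

lemma sphere_map_inner_derivative:
  fixes f :: "complex \<Rightarrow> real^4"
  assumes "open S" "z \<in> S" "f differentiable (at z)" "f ` S \<subseteq> sphere 0 1"
  shows "f z \<bullet> frechet_derivative f (at z) h = 0"
proof -
  let ?D = "frechet_derivative f (at z)"
  have "(f has_derivative ?D) (at z)"
    using assms(3) frechet_derivative_works by blast
  then have "((\<lambda>w. f w \<bullet> f w) has_derivative (\<lambda>h. f z \<bullet> ?D h + ?D h \<bullet> f z)) (at z)"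
    by (intro has_derivative_inner)
  moreover have "((\<lambda>w. f w \<bullet> f w) has_derivative (\<lambda>h. 0)) (at z)"
  proof (rule has_derivative_transform_within_open [OF has_derivative_const [of 1] assms(1,2)])
    fix w assume "w \<in> S"
    then show "1 = f w \<bullet> f w"
      using assms(4) by (auto simp: dot_square_norm)
  qed
  ultimately have "(\<lambda>h. f z \<bullet> ?D h + ?D h \<bullet> f z) = (\<lambda>h. 0)"
    by (rule has_derivative_unique)
  from fun_cong [OF this, of h] show ?thesis by (simp add: inner_commute)
qed

lemma
  assumes "open S" "z \<in> S" "harmonic_map_S3 S f"
  shows alpha_works: "pdx f z = f z \<odot> im (alpha f z)"
    and beta_works: "pdy f z = f z \<odot> im (beta f z)"
proof -
  have *: "f differentiable (at z)" "f ` S \<subseteq> sphere 0 1"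
    using assms unfolding harmonic_map_S3_def smooth_map_on_def
    by (metis ck_on.simps(2), blast)
  have n: "norm (f z) = 1" using * assms(2) by auto
  note D = sphere_map_inner_derivative [OF assms(1,2) *]
  show "pdx f z = f z \<odot> im (alpha f z)"
    unfolding alpha_def
    by (rule theI' [OF tangent_eq_qmul_im [OF n]]) (simp add: pdx_def D)
  show "pdy f z = f z \<odot> im (beta f z)"
    unfolding beta_def
    by (rule theI' [OF tangent_eq_qmul_im [OF n]]) (simp add: pdy_def D)
qed

lemma pd_cplx:
  assumes "f differentiable (at z)"
  shows "pdx (\<lambda>w. cplx (f w)) z = cplx (pdx f z)"
    and "pdy (\<lambda>w. cplx (f w)) z = cplx (pdy f z)"
proof -
  have "bounded_linear (cplx :: real^'n \<Rightarrow> complex^'n)"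
    by (rule linear_conv_bounded_linear [THEN iffD1])
      (intro linearI; simp add: cplx_def vec_eq_iff complex_eq_iff)
  then have "((\<lambda>w. cplx (f w)) has_derivative (\<lambda>h. cplx (frechet_derivative f (at z) h))) (at z)"
    using assms frechet_derivative_works bounded_linear.has_derivative by blast
  then have "frechet_derivative (\<lambda>w. cplx (f w)) (at z) = (\<lambda>h. cplx (frechet_derivative f (at z) h))"
    using frechet_derivative_at by metis
  then show "pdx (\<lambda>w. cplx (f w)) z = cplx (pdx f z)" "pdy (\<lambda>w. cplx (f w)) z = cplx (pdy f z)"
    by (simp_all add: pdx_def pdy_def)
qed

lemma scalar_product_del:
  fixes f :: "complex \<Rightarrow> real^4"
  assumes "f differentiable (at z)"
  shows "scalar_product (del f z) (del f z) =
    Complex ((pdx f z \<bullet> pdx f z - pdy f z \<bullet> pdy f z) / 4) (- (pdx f z \<bullet> pdy f z) / 2)"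
  unfolding dz_def pd_cplx [OF assms]
  by (simp add: scalar_product_def cplx_def sum_4 inner_vec_def complex_eq_iff field_simps)

lemma alpha_beta_adapted:
  assumes "open S" "z \<in> S" "harmonic_map_S3 S f" "adapted_coordinate S f"
  shows "alpha f z \<bullet> beta f z = 0" "(norm (beta f z))\<^sup>2 = (norm (alpha f z))\<^sup>2 + 4"
proof -
  have *: "f differentiable (at z)" "norm (f z) = 1"
    using assms(2,3) unfolding harmonic_map_S3_def smooth_map_on_def
    by (metis ck_on.simps(2), force)
  have "Complex ((pdx f z \<bullet> pdx f z - pdy f z \<bullet> pdy f z) / 4) (- (pdx f z \<bullet> pdy f z) / 2) = -1"
    using assms(2,4) scalar_product_del [OF *(1)] by (simp add: adapted_coordinate_def)
  then show "alpha f z \<bullet> beta f z = 0" "(norm (beta f z))\<^sup>2 = (norm (alpha f z))\<^sup>2 + 4"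
    unfolding alpha_works [OF assms(1-3)] beta_works [OF assms(1-3)] power2_norm_eq_inner
    by (simp_all add: inner_qmul_left *(2) complex_eq_iff)
qed

lemma phi_works:
  assumes "open S" "z \<in> S" "harmonic_map_S3 S f" "adapted_coordinate S f"
  shows "0 \<le> phi f z" "norm (alpha f z) = 2 * sinh (phi f z)" "norm (beta f z) = 2 * cosh (phi f z)"
proof -
  let ?P = "\<lambda>t. 0 \<le> t \<and> norm (alpha f z) = 2 * sinh t \<and> norm (beta f z) = 2 * cosh t"
  define t where "t = arsinh (norm (alpha f z) / 2)"
  have s: "norm (alpha f z) = 2 * sinh t" by (simp add: t_def)
  then have "0 \<le> sinh t" using norm_ge_zero [of "alpha f z"] by linarith
  then have "0 \<le> t" by simp
  have "(norm (beta f z))\<^sup>2 = (2 * cosh t)\<^sup>2"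
    unfolding alpha_beta_adapted(2) [OF assms] s
    by (simp add: power_mult_distrib cosh_square_eq)
  then have "norm (beta f z) = 2 * cosh t"
    by (rule power2_eq_imp_eq) simp_all
  with s \<open>0 \<le> t\<close> have "?P t" by simp
  moreover have "u = t" if "?P u" for u using that s by simp
  ultimately have "?P (phi f z)" unfolding phi_def by (rule theI)
  then show "0 \<le> phi f z" "norm (alpha f z) = 2 * sinh (phi f z)"
    "norm (beta f z) = 2 * cosh (phi f z)" by auto
qed

lemma
  assumes "open S" "z \<in> S" "harmonic_map_S3 S f" "adapted_coordinate S f" "alpha f z \<noteq> 0"
  shows plus_transform_eq:
      "cplx (plus_transform f z) =
        (\<i> / 2 * complex_of_real (1 / (cosh (phi f z))\<^sup>2)) *s (del f z - delbar f z) +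
        cplx (tanh (phi f z) *\<^sub>R unit_normal f z)" (is ?plus)
    and minus_transform_eq:
      "cplx (minus_transform f z) =
        (- \<i> / 2 * complex_of_real (1 / (cosh (phi f z))\<^sup>2)) *s (del f z - delbar f z) +
        cplx (tanh (phi f z) *\<^sub>R unit_normal f z)" (is ?minus)
proof -
  have d: "f differentiable (at z)"
    using assms(2,3) unfolding harmonic_map_S3_def smooth_map_on_def
    by (metis ck_on.simps(2))
  have s: "sinh (phi f z) \<noteq> 0" using phi_works(2) [OF assms(1-4)] assms(5) by auto
  have c: "tanh (phi f z) * (1 / (2 * sinh (2 * phi f z))) = 1 / (4 * (cosh (phi f z))\<^sup>2)"
    unfolding tanh_def sinh_double power2_eq_square using s by (simp add: divide_simps)
  have "del f z - delbar f z = (- \<i>) *s cplx (pdy f z)"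
    by (simp add: dz_def dzbar_def pd_cplx [OF d] vec_eq_iff algebra_simps)
  then have e: "del f z - delbar f z = (- \<i>) *s cplx (f z \<odot> im (beta f z))"
    by (simp only: beta_works [OF assms(1-3)])
  have u: "tanh (phi f z) *\<^sub>R unit_normal f z =
      (1 / (4 * (cosh (phi f z))\<^sup>2)) *\<^sub>R (f z \<odot> im (alpha f z \<times> beta f z))"
    by (simp only: unit_normal_def scaleR_scaleR c)
  show ?plus
    unfolding e u plus_transform_def
    by (simp add: cplx_def vec_eq_iff forall_4 qmul_def im_def) (simp add: field_simps)
  show ?minus
    unfolding e u minus_transform_def
    by (simp add: cplx_def vec_eq_iff forall_4 qmul_def im_def) (simp add: field_simps)
qed

end

theory Submission
  imports Defs
begin

text \<open>Put \<open>\<sigma> = \<plusminus>1\<close>. The transform \<open>g\<close> of \<open>f\<close> is a unit vector field with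
  \<open>g \<bullet> f = 0\<close>, \<open>g \<bullet> f\<^sub>x = 0\<close> and \<open>g \<bullet> f\<^sub>y = 2\<sigma>\<close>. Differentiating these relations and using that
  the Laplacian of \<open>f\<close> is a multiple of \<open>f\<close> determines \<open>g\<^sub>x\<close> and \<open>g\<^sub>y\<close> well enough to see that
  \<open>z\<close> is adapted to \<open>g\<close>. Adaptedness makes the Laplacian of \<open>g\<close> orthogonal to \<open>g\<^sub>x\<close> and \<open>g\<^sub>y\<close>,
  and it is orthogonal to \<open>f\<close> because \<open>f \<bullet> g\<^sub>x = 0\<close> and \<open>f \<bullet> g\<^sub>y = -2\<sigma>\<close>; where \<open>g\<^sub>x \<noteq> 0\<close>
  only the direction of \<open>g\<close> is left, which is harmonicity. The points with \<open>g\<^sub>x \<noteq> 0\<close> are dense,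
  so the harmonic map equation extends to \<open>S\<close> by continuity.\<close>

section \<open>Partial derivatives\<close>

lemma pd_eqI:
  assumes "(f has_derivative D) (at z)"
  shows "pdx f z = D 1" "pdy f z = D \<i>"
  using frechet_derivative_at [OF assms] by (simp_all add: pdx_def pdy_def)

lemma has_derivative_cong_open:
  assumes "open S" "z \<in> S" "\<And>w. w \<in> S \<Longrightarrow> f w = g w"
  shows "(f has_derivative D) (at z) \<longleftrightarrow> (g has_derivative D) (at z)"
  using has_derivative_transform_within_open [OF _ assms(1,2)] assms(3) by metis

lemma differentiable_cong_open:
  assumes "open S" "z \<in> S" "\<And>w. w \<in> S \<Longrightarrow> f w = g w"
  shows "f differentiable (at z) \<longleftrightarrow> g differentiable (at z)"
  using has_derivative_cong_open [OF assms] by (simp add: differentiable_def)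

lemma pd_cong_open:
  assumes "open S" "z \<in> S" "\<And>w. w \<in> S \<Longrightarrow> f w = g w"
  shows "pdx f z = pdx g z" "pdy f z = pdy g z"
  using has_derivative_cong_open [OF assms]
  by (simp_all add: pdx_def pdy_def frechet_derivative_def)

lemma pd_const [simp]: "pdx (\<lambda>w. c) z = 0" "pdy (\<lambda>w. c) z = 0"
  using pd_eqI [OF has_derivative_const] by auto

lemma pd_add:
  assumes "f differentiable (at z)" "g differentiable (at z)"
  shows "pdx (\<lambda>w. f w + g w) z = pdx f z + pdx g z"
    and "pdy (\<lambda>w. f w + g w) z = pdy f z + pdy g z"
  using pd_eqI [OF has_derivative_add] assms
  by (simp_all add: frechet_derivative_works pdx_def pdy_def)

lemma pd_linear:
  assumes "bounded_linear L" "f differentiable (at z)"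
  shows "pdx (\<lambda>w. L (f w)) z = L (pdx f z)"
    and "pdy (\<lambda>w. L (f w)) z = L (pdy f z)"
  using pd_eqI [OF bounded_linear.has_derivative [OF assms(1)]] assms(2)
  by (simp_all add: frechet_derivative_works pdx_def pdy_def)

lemma pd_bilinear:
  assumes "bounded_bilinear B" "f differentiable (at z)" "g differentiable (at z)"
  shows "pdx (\<lambda>w. B (f w) (g w)) z = B (f z) (pdx g z) + B (pdx f z) (g z)"
    and "pdy (\<lambda>w. B (f w) (g w)) z = B (f z) (pdy g z) + B (pdy f z) (g z)"
  using pd_eqI [OF bounded_bilinear.FDERIV [OF assms(1)]] assms(2,3)
  by (simp_all add: frechet_derivative_works pdx_def pdy_def)


lemma pd_inverse:
  fixes h :: "complex \<Rightarrow> real"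
  assumes "h differentiable (at z)" "h z \<noteq> 0"
  shows "pdx (\<lambda>w. inverse (h w)) z = - (inverse (h z) * inverse (h z) * pdx h z)"
    and "pdy (\<lambda>w. inverse (h w)) z = - (inverse (h z) * inverse (h z) * pdy h z)"
  using pd_eqI [OF Deriv.has_derivative_inverse [of h z, OF assms(2)]] assms(1)
  by (simp_all add: frechet_derivative_works pdx_def pdy_def mult.commute mult.left_commute)

text \<open>The device by which every pointwise relation between \<open>f\<close>, \<open>g\<close>
  and their derivatives is differentiated below.\<close>

lemma pd_inner_const:
  fixes u v :: "complex \<Rightarrow> 'a::real_inner"
  assumes "open S" "z \<in> S" "u differentiable (at z)" "v differentiable (at z)"
    "\<And>w. w \<in> S \<Longrightarrow> u w \<bullet> v w = c"
  shows "pdx u z \<bullet> v z + u z \<bullet> pdx v z = 0" "pdy u z \<bullet> v z + u z \<bullet> pdy v z = 0"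
  using pd_cong_open [OF assms(1,2), of "\<lambda>w. u w \<bullet> v w" "\<lambda>w. c"]
    pd_bilinear [OF bounded_bilinear_inner assms(3,4)] assms(5)
  by simp_all

section \<open>Closure properties of smooth maps\<close>

text \<open>The product rule leaves one factor undifferentiated, so inductions on the order have to
  lower the order of that factor.\<close>

lemma ck_on_SucD: "ck_on (Suc k) S f \<Longrightarrow> ck_on k S f"
proof (induction k arbitrary: f)
  case 0
  then show ?case
    by (simp add: continuous_at_imp_continuous_on differentiable_imp_continuous_within)
next
  case (Suc k)
  then show ?case by (metis ck_on.simps(2))
qed

text \<open>Openness of \<open>S\<close> makes all derivatives local. This later transfers
  smoothness from an explicit formula to the transform, whose ingredients are definite
  descriptions.\<close>

lemma ck_on_cong:
  assumes "open S" "\<And>w. w \<in> S \<Longrightarrow> f w = g w"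
  shows "ck_on k S f \<longleftrightarrow> ck_on k S g"
  using assms(2)
proof (induction k arbitrary: f g)
  case 0
  then show ?case by (simp cong: continuous_on_cong)
next
  case (Suc k)
  have "ck_on k S (pdx f) \<longleftrightarrow> ck_on k S (pdx g)" "ck_on k S (pdy f) \<longleftrightarrow> ck_on k S (pdy g)"
    using pd_cong_open [OF assms(1)] Suc by blast+
  moreover have "\<forall>z\<in>S. f differentiable (at z) \<longleftrightarrow> g differentiable (at z)"
    using differentiable_cong_open [OF assms(1)] Suc.prems by blast
  ultimately show ?case by simp
qed

lemma ck_on_add:
  assumes "open S" "ck_on k S f" "ck_on k S g"
  shows "ck_on k S (\<lambda>w. f w + g w)"
  using assms(2,3)
proof (induction k arbitrary: f g)
  case 0
  then show ?case by (simp add: continuous_on_add)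
next
  case (Suc k)
  have "ck_on k S (pdx (\<lambda>w. f w + g w)) \<longleftrightarrow> ck_on k S (\<lambda>w. pdx f w + pdx g w)"
    "ck_on k S (pdy (\<lambda>w. f w + g w)) \<longleftrightarrow> ck_on k S (\<lambda>w. pdy f w + pdy g w)"
    using Suc.prems by (intro ck_on_cong [OF assms(1)]; simp add: pd_add)+
  with Suc show ?case by simp
qed

lemma ck_on_linear:
  assumes "open S" "bounded_linear L" "ck_on k S f"
  shows "ck_on k S (\<lambda>w. L (f w))"
  using assms(3)
proof (induction k arbitrary: f)
  case 0
  then show ?case by (simp add: bounded_linear.continuous_on [OF assms(2)])
next
  case (Suc k)
  have "ck_on k S (pdx (\<lambda>w. L (f w))) \<longleftrightarrow> ck_on k S (\<lambda>w. L (pdx f w))"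
    "ck_on k S (pdy (\<lambda>w. L (f w))) \<longleftrightarrow> ck_on k S (\<lambda>w. L (pdy f w))"
    using Suc.prems by (intro ck_on_cong [OF assms(1)]; simp add: pd_linear [OF assms(2)])+
  moreover have "(\<lambda>w. L (f w)) differentiable (at z)" if "z \<in> S" for z
    using Suc.prems that bounded_linear.has_derivative [OF assms(2)]
    unfolding differentiable_def by (simp add: differentiable_def) blast
  ultimately show ?case using Suc by simp
qed

lemma ck_on_bilinear:
  assumes "open S" "bounded_bilinear B" "ck_on k S f" "ck_on k S g"
  shows "ck_on k S (\<lambda>w. B (f w) (g w))"
  using assms(3,4)
proof (induction k arbitrary: f g)
  case 0
  then show ?case by (simp add: bounded_bilinear.continuous_on [OF assms(2)])
next
  case (Suc k)
  have "ck_on k S (pdx (\<lambda>w. B (f w) (g w))) \<longleftrightarrow>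
      ck_on k S (\<lambda>w. B (f w) (pdx g w) + B (pdx f w) (g w))"
    "ck_on k S (pdy (\<lambda>w. B (f w) (g w))) \<longleftrightarrow>
      ck_on k S (\<lambda>w. B (f w) (pdy g w) + B (pdy f w) (g w))"
    using Suc.prems by (intro ck_on_cong [OF assms(1)]; simp add: pd_bilinear [OF assms(2)])+
  moreover have "ck_on k S f" "ck_on k S g"
    using Suc.prems ck_on_SucD by blast+
  moreover have "(\<lambda>w. B (f w) (g w)) differentiable (at z)" if "z \<in> S" for z
    using Suc.prems that bounded_bilinear.FDERIV [OF assms(2)]
    unfolding differentiable_def by (simp add: differentiable_def) blast
  ultimately show ?case using Suc by (simp add: ck_on_add [OF assms(1)])
qed

text \<open>The derivatives of 1/h are -(1/h)(1/h)h_x and -(1/h)(1/h)h_y, so order k of 1/h itself,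
  together with order k of h_x and h_y, yields order k + 1; \<open>h\<close> stays fixed in the
  induction.\<close>

lemma ck_on_inverse:
  fixes h :: "complex \<Rightarrow> real"
  assumes "open S" "\<And>w. w \<in> S \<Longrightarrow> h w \<noteq> 0" "ck_on k S h"
  shows "ck_on k S (\<lambda>w. inverse (h w))"
  using assms(3)
proof (induction k)
  case 0
  then show ?case using assms(2) by (simp add: continuous_on_inverse)
next
  case (Suc k)
  have "ck_on k S (pdx (\<lambda>w. inverse (h w))) \<longleftrightarrow>
      ck_on k S (\<lambda>w. - (inverse (h w) * inverse (h w) * pdx h w))"
    "ck_on k S (pdy (\<lambda>w. inverse (h w))) \<longleftrightarrow>
      ck_on k S (\<lambda>w. - (inverse (h w) * inverse (h w) * pdy h w))"
    using Suc.prems assms(2) by (intro ck_on_cong [OF assms(1)]; simp add: pd_inverse)+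
  moreover have "ck_on k S (\<lambda>w. inverse (h w))"
    using Suc ck_on_SucD by blast
  moreover have "(\<lambda>w. inverse (h w)) differentiable (at z)" if "z \<in> S" for z
    using Suc.prems that assms(2) by (auto intro: differentiable_inverse)
  ultimately show ?case using Suc.prems
    by (simp add: ck_on_linear [OF assms(1) bounded_linear_minus [OF bounded_linear_ident]]
        ck_on_bilinear [OF assms(1) bounded_bilinear_mult])
qed

lemma smooth_map_onD:
  assumes "smooth_map_on S f"
  shows "z \<in> S \<Longrightarrow> f differentiable (at z)" "smooth_map_on S (pdx f)" "smooth_map_on S (pdy f)"
    "continuous_on S f"
  using assms ck_on.simps unfolding smooth_map_on_def by (metis, metis, metis, metis)

section \<open>Symmetry of second derivatives\<close>

lemma has_derivative_shift:
  fixes h :: "complex \<Rightarrow> 'a::real_normed_vector"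
  assumes "h differentiable (at (w + c))"
  shows "((\<lambda>w. h (w + c)) has_derivative frechet_derivative h (at (w + c))) (at w)"
proof -
  have "((\<lambda>w. w + c) has_derivative (\<lambda>v. v)) (at w)"
    by (auto intro!: derivative_eq_intros)
  then show ?thesis
    using has_derivative_compose assms frechet_derivative_works by blast
qed

lemma MVT_direction:
  fixes h :: "complex \<Rightarrow> real"
  assumes "0 < t" "\<And>s. \<lbrakk>0 \<le> s; s \<le> t\<rbrakk> \<Longrightarrow> h differentiable (at (z + of_real s * d))"
  shows "\<exists>s. 0 < s \<and> s < t \<and>
    h (z + of_real t * d) - h z = t * frechet_derivative h (at (z + of_real s * d)) d"
proof -
  have "((\<lambda>s. h (z + of_real s * d)) has_real_derivative
      frechet_derivative h (at (z + of_real s * d)) d) (at s)"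
    if "0 \<le> s" "s \<le> t" for s
  proof -
    let ?D = "frechet_derivative h (at (z + of_real s * d))"
    have D: "(h has_derivative ?D) (at (z + of_real s * d))"
      using assms(2) that frechet_derivative_works by blast
    have "((\<lambda>s. z + of_real s * d) has_derivative (\<lambda>k. of_real k * d)) (at s)"
      by (auto intro!: derivative_eq_intros)
    from has_derivative_compose [OF this D]
    have "((\<lambda>s. h (z + of_real s * d)) has_derivative (\<lambda>k. ?D (of_real k * d))) (at s)" .
    \<comment> \<open>The differential is only real-linear, so the complex product with a real
      number has to be read as a real scaling.\<close>
    moreover have "?D (of_real k * d) = ?D d * k" for k
      using linear_scale [OF has_derivative_linear [OF D], of k d]
      by (simp add: scaleR_conv_of_real)
    ultimately show ?thesis by (simp add: has_field_derivative_def)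
  qed
  from MVT2 [OF assms(1) this] show ?thesis by auto
qed

text \<open>Two mean value theorems: one in direction \<open>d\<close> for the increment of
  \<open>h\<close> along \<open>e\<close>, one in direction \<open>e\<close> for the derivative
  along \<open>d\<close>. Keeping \<open>d\<close> and \<open>e\<close> arbitrary covers both orders
  of differentiation.\<close>

lemma second_difference:
  fixes h :: "complex \<Rightarrow> real"
  assumes "0 < t"
    and S: "\<And>a b. \<lbrakk>0 \<le> a; a \<le> t; 0 \<le> b; b \<le> t\<rbrakk> \<Longrightarrow> z + of_real a * d + of_real b * e \<in> S"
    and h: "\<And>w. w \<in> S \<Longrightarrow> h differentiable (at w)"
    and k: "\<And>w. w \<in> S \<Longrightarrow> (\<lambda>w. frechet_derivative h (at w) d) differentiable (at w)"
  shows "\<exists>a b. 0 < a \<and> a < t \<and> 0 < b \<and> b < t \<and>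
    h (z + of_real t * d + of_real t * e) - h (z + of_real t * d) - h (z + of_real t * e) + h z =
    t * t * frechet_derivative (\<lambda>w. frechet_derivative h (at w) d) (at (z + of_real a * d + of_real b * e)) e"
proof -
  let ?T = "of_real t * e :: complex"
  let ?k = "\<lambda>w. h (w + ?T) - h w"
  have D: "(?k has_derivative (\<lambda>v. frechet_derivative h (at (z + of_real a * d + ?T)) v
      - frechet_derivative h (at (z + of_real a * d)) v)) (at (z + of_real a * d))"
    if "0 \<le> a" "a \<le> t" for a
    using S [OF that, of t] S [OF that, of 0] assms(1) h
    by (intro has_derivative_diff has_derivative_shift) (auto simp: frechet_derivative_works [symmetric])
  then have "?k differentiable (at (z + of_real a * d))" if "0 \<le> a" "a \<le> t" for a
    using that by (auto simp: differentiable_def)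
  from MVT_direction [OF assms(1) this] obtain a where a: "0 < a" "a < t"
    "?k (z + of_real t * d) - ?k z = t * frechet_derivative ?k (at (z + of_real a * d)) d"
    by auto
  moreover have "frechet_derivative ?k (at (z + of_real a * d)) d =
      frechet_derivative h (at (z + of_real a * d + ?T)) d - frechet_derivative h (at (z + of_real a * d)) d"
    using fun_cong [OF frechet_derivative_at [OF D [OF less_imp_le less_imp_le, OF a(1,2)]], of d]
    by (rule sym)
  moreover obtain b where "0 < b" "b < t"
    "frechet_derivative h (at (z + of_real a * d + ?T)) d - frechet_derivative h (at (z + of_real a * d)) d =
      t * frechet_derivative (\<lambda>w. frechet_derivative h (at w) d) (at (z + of_real a * d + of_real b * e)) e"
    using MVT_direction [OF assms(1), of "\<lambda>w. frechet_derivative h (at w) d" "z + of_real a * d" e] k S a(1,2)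
    by (meson less_imp_le)
  ultimately show ?thesis
    by (intro exI [of _ a] exI [of _ b]) (simp add: algebra_simps)
qed

text \<open>Schwarz's theorem. The second difference over a small square is symmetric in the two
  directions, so it equals t*t times either mixed derivative at some point of the square; continuity
  at \<open>z\<close> does the rest.\<close>

lemma pd_commute_real:
  fixes h :: "complex \<Rightarrow> real"
  assumes "open S" "z \<in> S" "ck_on 2 S h"
  shows "pdx (pdy h) z = pdy (pdx h) z"
proof (rule ccontr)
  have ck: "\<And>w. w \<in> S \<Longrightarrow> h differentiable (at w)"
    "\<And>w. w \<in> S \<Longrightarrow> pdx h differentiable (at w)" "\<And>w. w \<in> S \<Longrightarrow> pdy h differentiable (at w)"
    "continuous_on S (pdy (pdx h))" "continuous_on S (pdx (pdy h))"
    using assms(3) by (auto simp: numeral_2_eq_2)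
  assume "pdx (pdy h) z \<noteq> pdy (pdx h) z"
  \<comment> \<open>Half the supposed gap: two deviations below \<open>e\<close> cannot bridge
    it.\<close>
  define e where "e = \<bar>pdx (pdy h) z - pdy (pdx h) z\<bar> / 2"
  then have "0 < e" using \<open>pdx (pdy h) z \<noteq> pdy (pdx h) z\<close> by simp
  obtain r where r: "0 < r" "ball z r \<subseteq> S"
    using assms(1,2) open_contains_ball by blast
  obtain r1 where r1: "0 < r1" "\<And>w. w \<in> S \<Longrightarrow> dist w z < r1 \<Longrightarrow> dist (pdy (pdx h) w) (pdy (pdx h) z) < e"
    using ck(4) \<open>0 < e\<close> assms(2) unfolding continuous_on_iff by blast
  obtain r2 where r2: "0 < r2" "\<And>w. w \<in> S \<Longrightarrow> dist w z < r2 \<Longrightarrow> dist (pdx (pdy h) w) (pdx (pdy h) z) < e"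
    using ck(5) \<open>0 < e\<close> assms(2) unfolding continuous_on_iff by blast
  \<comment> \<open>Points of the square lie within 2t of \<open>z\<close>; dividing by 3 keeps 2t
    strictly below all three radii.\<close>
  define t where "t = min r (min r1 r2) / 3"
  have t: "0 < t" "2 * t < r" "2 * t < r1" "2 * t < r2"
    using r(1) r1(1) r2(1) by (auto simp: t_def)
  have d: "dist (z + of_real a + of_real b * \<i>) z \<le> 2 * t" if "0 \<le> a" "a \<le> t" "0 \<le> b" "b \<le> t" for a b
    using norm_triangle_ineq [of "of_real a" "of_real b * \<i>"] that
    by (simp add: dist_norm norm_mult add.assoc)
  have S: "z + of_real a + of_real b * \<i> \<in> S" if "0 \<le> a" "a \<le> t" "0 \<le> b" "b \<le> t" for a b
    using d [OF that] t r(2) by (auto simp: subset_eq dist_commute)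
  have S': "z + of_real b * \<i> + of_real a \<in> S" if "0 \<le> b" "b \<le> t" "0 \<le> a" "a \<le> t" for a b
    using S [OF that(3,4,1,2)] by (simp add: algebra_simps)
  obtain a b where 1: "0 < a" "a < t" "0 < b" "b < t"
    "h (z + of_real t + of_real t * \<i>) - h (z + of_real t) - h (z + of_real t * \<i>) + h z =
      t * t * pdy (pdx h) (z + of_real a + of_real b * \<i>)"
    using second_difference [OF t(1), of z 1 \<i> S h] S ck(1,2) unfolding pdx_def pdy_def by auto
  obtain b' a' where 2: "0 < b'" "b' < t" "0 < a'" "a' < t"
    "h (z + of_real t * \<i> + of_real t) - h (z + of_real t * \<i>) - h (z + of_real t) + h z =
      t * t * pdx (pdy h) (z + of_real b' * \<i> + of_real a')"
    using second_difference [OF t(1), of z \<i> 1 S h] S' ck(1,3) unfolding pdx_def pdy_def by auto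
  have "t * t * pdy (pdx h) (z + of_real a + of_real b * \<i>) =
      t * t * pdx (pdy h) (z + of_real a' + of_real b' * \<i>)"
    using 1(5) 2(5) by (simp add: algebra_simps)
  then have "pdy (pdx h) (z + of_real a + of_real b * \<i>) = pdx (pdy h) (z + of_real a' + of_real b' * \<i>)"
    using t(1) by simp
  moreover have "dist (pdy (pdx h) (z + of_real a + of_real b * \<i>)) (pdy (pdx h) z) < e"
    using r1(2) [OF S [of a b]] d [of a b] 1 t by auto
  moreover have "dist (pdx (pdy h) (z + of_real a' + of_real b' * \<i>)) (pdx (pdy h) z) < e"
    using r2(2) [OF S [of a' b']] d [of a' b'] 2 t by auto
  ultimately have "dist (pdx (pdy h) z) (pdy (pdx h) z) < 2 * e"
    using dist_triangle_half_r [of _ _ "2 * e"] by simp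
  then show False by (simp add: e_def dist_real_def)
qed

lemma pd_commute:
  fixes g :: "complex \<Rightarrow> 'a::real_inner"
  assumes "open S" "z \<in> S" "smooth_map_on S g"
  shows "pdx (pdy g) z = pdy (pdx g) z"
proof -
  \<comment> \<open>Pairing \<open>g\<close> with the supposed defect \<open>v\<close> itself
    reduces the claim to a real function and ends in \<open>v \<bullet> v = 0\<close>.\<close>
  define v where "v = pdx (pdy g) z - pdy (pdx g) z"
  define h where "h = (\<lambda>w. g w \<bullet> v)"
  note L = bounded_linear_inner_left [of v]
  have "ck_on 2 S h"
    unfolding h_def using assms by (intro ck_on_linear [OF _ L]) (auto simp: smooth_map_on_def)
  then have "pdx (pdy h) z = pdy (pdx h) z"
    by (rule pd_commute_real [OF assms(1,2)])
  moreover have "pdx (pdy h) z = pdx (\<lambda>w. pdy g w \<bullet> v) z" "pdy (pdx h) z = pdy (\<lambda>w. pdx g w \<bullet> v) z"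
    using smooth_map_onD [OF assms(3)] unfolding h_def
    by (auto intro!: pd_cong_open [OF assms(1,2)] simp: pd_linear [OF L])
  moreover have "pdx (\<lambda>w. pdy g w \<bullet> v) z = pdx (pdy g) z \<bullet> v"
    "pdy (\<lambda>w. pdx g w \<bullet> v) z = pdy (pdx g) z \<bullet> v"
    using smooth_map_onD [OF assms(3)] smooth_map_onD(1) assms(2)
    by (blast intro: pd_linear [OF L])+
  ultimately have "v \<bullet> v = 0"
    by (simp add: v_def inner_diff_left)
  then show ?thesis by (simp add: v_def)
qed

section \<open>The harmonic map equation in real terms\<close>

lemma bounded_linear_cplx: "bounded_linear (\<lambda>v. c *s cplx (v :: real^'n))"
  by (rule linear_conv_bounded_linear [THEN iffD1])
    (intro linearI; simp add: cplx_def vec_eq_iff complex_eq_iff algebra_simps)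

text \<open>The operator is a quarter of the Laplacian; its imaginary part is the difference of the
  mixed derivatives and vanishes by symmetry.\<close>

lemma dz_delbar:
  fixes g :: "complex \<Rightarrow> real^'n"
  assumes "open S" "z \<in> S" "smooth_map_on S g"
  shows "dz (delbar g) z = cplx ((1/4) *\<^sub>R (pdx (pdx g) z + pdy (pdy g) z))"
proof -
  note sm = smooth_map_onD [OF assms(3)]
  note d = smooth_map_onD(1) [OF sm(2) assms(2)] smooth_map_onD(1) [OF sm(3) assms(2)]
  have L: "bounded_linear (\<lambda>v :: real^'n. (1/2) *s cplx v)" "bounded_linear (\<lambda>v :: real^'n. (\<i>/2) *s cplx v)"
    by (rule bounded_linear_cplx)+
  have e: "delbar g w = (1/2) *s cplx (pdx g w) + (\<i>/2) *s cplx (pdy g w)" if "w \<in> S" for w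
    unfolding dzbar_def pd_cplx [OF sm(1) [OF that]] by (simp add: vec_eq_iff algebra_simps)
  have D: "(\<lambda>w. (c/2) *s cplx (h w)) differentiable (at z)" if "h differentiable (at z)" for c and h :: "complex \<Rightarrow> real^'n"
    using bounded_linear.has_derivative [OF bounded_linear_cplx] that unfolding differentiable_def by blast
  have pd: "pdx (delbar g) z = (1/2) *s cplx (pdx (pdx g) z) + (\<i>/2) *s cplx (pdx (pdy g) z)"
    "pdy (delbar g) z = (1/2) *s cplx (pdy (pdx g) z) + (\<i>/2) *s cplx (pdy (pdy g) z)"
    using pd_cong_open [OF assms(1,2) e] pd_add [OF D [OF d(1), of 1] D [OF d(2), of \<i>]]
      pd_linear [OF L(1) d(1)] pd_linear [OF L(2) d(2)]
    by simp_all
  show ?thesis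
    unfolding dz_def pd pd_commute [OF assms]
    by (simp add: vec_eq_iff complex_eq_iff cplx_def)
qed

lemma scalar_product_del_delbar:
  fixes g :: "complex \<Rightarrow> real^'n"
  assumes "g differentiable (at z)"
  shows "scalar_product (del g z) (delbar g z) =
    of_real ((pdx g z \<bullet> pdx g z + pdy g z \<bullet> pdy g z) / 4)"
  unfolding dz_def dzbar_def pd_cplx [OF assms]
  by (simp add: scalar_product_def cplx_def inner_vec_def complex_eq_iff sum_divide_distrib
      sum.distrib [symmetric] sum_negf [symmetric] sum_subtractf [symmetric] algebra_simps)
    (simp add: add_divide_distrib)

text \<open>Both sides of the complex equation are real and carry a factor 1/4. From here on only
  the real Laplacian is used.\<close>

lemma harmonic_equation_iff:
  fixes g :: "complex \<Rightarrow> real^4"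
  assumes "open S" "z \<in> S" "smooth_map_on S g"
  shows "dz (delbar g) z = - scalar_product (del g z) (delbar g z) *s cplx (g z) \<longleftrightarrow>
    pdx (pdx g) z + pdy (pdy g) z = - (pdx g z \<bullet> pdx g z + pdy g z \<bullet> pdy g z) *\<^sub>R g z"
  unfolding dz_delbar [OF assms] scalar_product_del_delbar [OF smooth_map_onD(1) [OF assms(3,2)]]
  by (simp add: vec_eq_iff complex_eq_iff cplx_def del: minus_add_distrib)

lemma adapted_coordinate_iff:
  fixes g :: "complex \<Rightarrow> real^4"
  assumes "smooth_map_on S g"
  shows "adapted_coordinate S g \<longleftrightarrow>
    (\<forall>z\<in>S. pdy g z \<bullet> pdy g z = pdx g z \<bullet> pdx g z + 4 \<and> pdx g z \<bullet> pdy g z = 0)"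
  unfolding adapted_coordinate_def
proof (rule ball_cong [OF refl])
  fix z assume "z \<in> S"
  from scalar_product_del [OF smooth_map_onD(1) [OF assms this]]
  show "scalar_product (del g z) (del g z) = - 1 \<longleftrightarrow>
    pdy g z \<bullet> pdy g z = pdx g z \<bullet> pdx g z + 4 \<and> pdx g z \<bullet> pdy g z = 0"
    by (auto simp: complex_eq_iff)
qed

text \<open>Otherwise there would be five nonzero pairwise orthogonal, hence independent, vectors in
  a space of dimension 4.\<close>

lemma orthogonal_to_basis_4:
  fixes a b c d v :: "real^4"
  assumes "a \<noteq> 0" "b \<noteq> 0" "c \<noteq> 0" "d \<noteq> 0"
    and "a \<bullet> b = 0" "a \<bullet> c = 0" "a \<bullet> d = 0" "b \<bullet> c = 0" "b \<bullet> d = 0" "c \<bullet> d = 0"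
    and "v \<bullet> a = 0" "v \<bullet> b = 0" "v \<bullet> c = 0" "v \<bullet> d = 0"
  shows "v = 0"
proof (rule ccontr)
  assume "v \<noteq> 0"
  let ?B = "{v, a, b, c, d}"
  have "pairwise orthogonal ?B"
    using assms by (auto simp: pairwise_insert orthogonal_def inner_commute)
  moreover have "0 \<notin> ?B" using assms \<open>v \<noteq> 0\<close> by auto
  ultimately have "independent ?B" by (rule pairwise_orthogonal_independent)
  then have "card ?B \<le> 4" using independent_bound [of ?B] by simp
  moreover have "card ?B = 5" using assms \<open>v \<noteq> 0\<close> by (auto simp: card_insert_if)
  ultimately show False by simp
qed

section \<open>Unit vector fields with prescribed products with the first jet\<close>

text \<open>Isolates the properties of the transform that imply the theorem, away from its
  quaternionic formula; the sign \<sigma> handles both transforms at once.\<close>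

locale transform_pair =
  fixes S :: "complex set" and f g :: "complex \<Rightarrow> real^4" and \<sigma> :: real
  assumes S: "open S"
    and f: "harmonic_map_S3 S f" "adapted_coordinate S f" "\<And>z. z \<in> S \<Longrightarrow> pdx f z \<noteq> 0"
    and g: "smooth_map_on S g"
    and \<sigma>: "\<sigma> * \<sigma> = 1"
    and gg: "\<And>z. z \<in> S \<Longrightarrow> g z \<bullet> g z = 1"
    and gf: "\<And>z. z \<in> S \<Longrightarrow> g z \<bullet> f z = 0"
    and gfx: "\<And>z. z \<in> S \<Longrightarrow> g z \<bullet> pdx f z = 0"
    and gfy: "\<And>z. z \<in> S \<Longrightarrow> g z \<bullet> pdy f z = 2 * \<sigma>"
begin

lemma smooth_f: "smooth_map_on S f"
  using f(1) by (simp add: harmonic_map_S3_def)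

lemma ff: "z \<in> S \<Longrightarrow> f z \<bullet> f z = 1"
  using f(1) by (auto simp: harmonic_map_S3_def dot_square_norm)

lemma f_adapted:
  assumes "z \<in> S"
  shows "pdy f z \<bullet> pdy f z = pdx f z \<bullet> pdx f z + 4" "pdx f z \<bullet> pdy f z = 0"
  using f(2) adapted_coordinate_iff [OF smooth_f] assms by auto

lemma f_laplace:
  assumes "z \<in> S"
  shows "pdx (pdx f) z + pdy (pdy f) z = - (pdx f z \<bullet> pdx f z + pdy f z \<bullet> pdy f z) *\<^sub>R f z"
  using f(1) assms harmonic_equation_iff [OF S assms smooth_f] by (simp add: harmonic_map_S3_def)

lemma differentiable_jet:
  assumes "z \<in> S"
  shows "f differentiable (at z)" "pdx f differentiable (at z)" "pdy f differentiable (at z)"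
    "g differentiable (at z)" "pdx g differentiable (at z)" "pdy g differentiable (at z)"
  using smooth_map_onD [OF g] smooth_map_onD [OF smooth_f] smooth_map_onD(1) assms by blast+

lemma f_orthogonal:
  assumes "z \<in> S"
  shows "f z \<bullet> pdx f z = 0" "f z \<bullet> pdy f z = 0"
  using pd_inner_const [OF S assms differentiable_jet(1) [OF assms] differentiable_jet(1) [OF assms] ff] by (simp_all add: inner_commute)

lemma g_orthogonal:
  assumes "z \<in> S"
  shows "g z \<bullet> pdx g z = 0" "g z \<bullet> pdy g z = 0"
  using pd_inner_const [OF S assms differentiable_jet(4) [OF assms] differentiable_jet(4) [OF assms] gg] by (simp_all add: inner_commute)

lemma first_derivative_products:
  assumes "z \<in> S"
  shows "pdx g z \<bullet> f z = 0" "pdy g z \<bullet> f z = - 2 * \<sigma>"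
    "pdy g z \<bullet> pdy f z = - (pdx g z \<bullet> pdx f z)" "pdy g z \<bullet> pdx f z = pdx g z \<bullet> pdy f z"
proof -
  note D = differentiable_jet [OF assms]
  note 0 = pd_inner_const [OF S assms D(4,1) gf]
  note 1 = pd_inner_const [OF S assms D(4,2) gfx]
  note 2 = pd_inner_const [OF S assms D(4,3) gfy]
  show "pdx g z \<bullet> f z = 0" "pdy g z \<bullet> f z = - 2 * \<sigma>"
    using 0 gfx [OF assms] gfy [OF assms] by simp_all
  \<comment> \<open>The Laplacian of \<open>f\<close> is a multiple of \<open>f\<close>, which is
    orthogonal to \<open>g\<close>. Added to the x-derivative of \<open>gfx\<close> and the
    y-derivative of \<open>gfy\<close>, this gives the trace relation.\<close>
  have "g z \<bullet> (pdx (pdx f) z + pdy (pdy f) z) = 0"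
    by (simp add: f_laplace [OF assms] gf [OF assms])
  then show "pdy g z \<bullet> pdy f z = - (pdx g z \<bullet> pdx f z)"
    using 1(1) 2(2) by (simp add: inner_add_right)
  \<comment> \<open>The symmetry relation compares the y-derivative of \<open>gfx\<close> with the
    x-derivative of \<open>gfy\<close>, which share the mixed derivative of
    \<open>f\<close>.\<close>
  show "pdy g z \<bullet> pdx f z = pdx g z \<bullet> pdy f z"
    using 1(2) 2(1) pd_commute [OF S assms smooth_f] by simp
qed

text \<open>The vectors \<open>f\<close>, \<open>g\<close>, \<open>f\<^sub>x\<close> and \<open>m = f\<^sub>y - 2\<sigma>g\<close> are pairwise orthogonal with
  \<open>|m| = |f\<^sub>x|\<close>; in this frame the differential of \<open>g\<close> is, up to the summand
  \<open>-2\<sigma>f\<close> of \<open>g\<^sub>y\<close>, a symmetric traceless matrix, so its columns have equal length and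
  are orthogonal.\<close>

lemma derivative_in_frame:
  fixes z
  defines "A \<equiv> pdx f z \<bullet> pdx f z" and "m \<equiv> pdy f z - (2 * \<sigma>) *\<^sub>R g z"
    and "p \<equiv> pdx g z \<bullet> pdx f z" and "q \<equiv> pdx g z \<bullet> pdy f z"
  assumes "z \<in> S"
  shows "A *\<^sub>R pdx g z = p *\<^sub>R pdx f z + q *\<^sub>R m"
    and "A *\<^sub>R (pdy g z + (2 * \<sigma>) *\<^sub>R f z) = q *\<^sub>R pdx f z - p *\<^sub>R m"
    and "m \<bullet> m = A" "m \<bullet> pdx f z = 0" "m \<bullet> f z = 0" "A > 0"
proof -
  note z = \<open>z \<in> S\<close>
  note facts = ff [OF z] f_adapted [OF z] f_orthogonal [OF z] gg [OF z] gf [OF z] gfx [OF z] gfy [OF z]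
    g_orthogonal [OF z] first_derivative_products [OF z]
  note exp = inner_add_left inner_add_right inner_diff_left inner_diff_right
    inner_scaleR_left inner_scaleR_right
  show A: "A > 0" using f(3) [OF z] by (simp add: A_def)
  have sym: "f z \<bullet> g z = 0" "pdx f z \<bullet> g z = 0" "pdy f z \<bullet> g z = 2 * \<sigma>"
    "pdx f z \<bullet> f z = 0" "pdy f z \<bullet> f z = 0" "pdy f z \<bullet> pdx f z = 0"
    "pdx g z \<bullet> g z = 0" "pdy g z \<bullet> g z = 0" "f z \<bullet> pdx g z = 0" "f z \<bullet> pdy g z = - 2 * \<sigma>"
    using facts by (simp_all add: inner_commute)
  \<comment> \<open>Here |m|^2 = |f_y|^2 - 8 + 4 = (A + 4) - 4.\<close>
  show mm: "m \<bullet> m = A"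
    using facts sym \<sigma> by (simp add: m_def A_def exp algebra_simps)
  show mx: "m \<bullet> pdx f z = 0" and mf: "m \<bullet> f z = 0"
    using facts sym by (simp_all add: m_def exp)
  have mg: "m \<bullet> g z = 0"
    using facts sym by (simp add: m_def exp)
  have sym': "pdx f z \<bullet> m = 0" "f z \<bullet> m = 0" "g z \<bullet> m = 0"
    using mx mf mg by (simp_all add: inner_commute)
  have gxm: "pdx g z \<bullet> m = q" "pdy g z \<bullet> m = - p"
    using facts sym by (simp_all add: m_def q_def p_def exp)
  have nz: "f z \<noteq> 0" "g z \<noteq> 0" "m \<noteq> 0"
    using facts A mm by auto
  note basis = orthogonal_to_basis_4 [OF nz(1,2) f(3) [OF z] nz(3)]
  \<comment> \<open>Each expansion is proved by comparing products with the four vectors of the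
    frame.\<close>
  have "A *\<^sub>R pdx g z - (p *\<^sub>R pdx f z + q *\<^sub>R m) = 0"
    by (rule basis) (simp_all add: facts sym sym' mx mf mg mm gxm exp flip: A_def p_def q_def)
  then show "A *\<^sub>R pdx g z = p *\<^sub>R pdx f z + q *\<^sub>R m" by simp
  have "A *\<^sub>R (pdy g z + (2 * \<sigma>) *\<^sub>R f z) - (q *\<^sub>R pdx f z - p *\<^sub>R m) = 0"
    by (rule basis) (simp_all add: facts sym sym' mx mf mg mm gxm exp flip: A_def p_def q_def)
  then show "A *\<^sub>R (pdy g z + (2 * \<sigma>) *\<^sub>R f z) = q *\<^sub>R pdx f z - p *\<^sub>R m" by simp
qed

text \<open>In the frame f_x, m the vectors A g_x and A k have coordinates (p, q) and (q, -p), hence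
  equal length and product 0. Since g_y = k - 2\<sigma>f with k orthogonal to f, passing from k to
  g_y adds 4 to the squared length.\<close>

lemma g_conformality:
  assumes "z \<in> S"
  shows "pdy g z \<bullet> pdy g z = pdx g z \<bullet> pdx g z + 4" "pdx g z \<bullet> pdy g z = 0"
proof -
  define A m p q where "A = pdx f z \<bullet> pdx f z" and "m = pdy f z - (2 * \<sigma>) *\<^sub>R g z"
    and "p = pdx g z \<bullet> pdx f z" and "q = pdx g z \<bullet> pdy f z"
  define k where "k = pdy g z + (2 * \<sigma>) *\<^sub>R f z"
  note * = derivative_in_frame [OF assms, folded A_def m_def p_def q_def, folded k_def]
  have xm: "pdx f z \<bullet> m = 0" using *(4) by (simp add: inner_commute)
  note exp = inner_add_left inner_add_right inner_diff_left inner_diff_right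
    inner_scaleR_left inner_scaleR_right
  have "A * A * (pdx g z \<bullet> pdx g z) = (A *\<^sub>R pdx g z) \<bullet> (A *\<^sub>R pdx g z)"
    "A * A * (k \<bullet> k) = (A *\<^sub>R k) \<bullet> (A *\<^sub>R k)"
    "A * A * (pdx g z \<bullet> k) = (A *\<^sub>R pdx g z) \<bullet> (A *\<^sub>R k)"
    by simp_all
  then have "A * A * (pdx g z \<bullet> pdx g z) = A * A * (k \<bullet> k)" "A * A * (pdx g z \<bullet> k) = 0"
    unfolding *(1,2) using *(3,4) xm by (simp_all add: exp A_def [symmetric] algebra_simps)
  then have k: "pdx g z \<bullet> pdx g z = k \<bullet> k" "pdx g z \<bullet> k = 0"
    using *(6) by simp_all
  have "k \<bullet> k = pdy g z \<bullet> pdy g z + 4 * \<sigma> * (pdy g z \<bullet> f z) + 4 * (\<sigma> * \<sigma>) * (f z \<bullet> f z)"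
    by (simp add: k_def exp inner_commute algebra_simps)
  also have "\<dots> = pdy g z \<bullet> pdy g z + 4 * (\<sigma> * \<sigma>) - 8 * (\<sigma> * \<sigma>)"
    by (simp add: first_derivative_products [OF assms] ff [OF assms])
  finally show "pdy g z \<bullet> pdy g z = pdx g z \<bullet> pdx g z + 4"
    using k(1) \<sigma> by simp
  show "pdx g z \<bullet> pdy g z = 0"
    using k(2) by (simp add: k_def exp first_derivative_products [OF assms])
qed

lemma g_adapted: "adapted_coordinate S g"
  using adapted_coordinate_iff [OF g] g_conformality by simp

text \<open>All four products come from differentiating constant ones: those of \<open>g\<close> and
  of \<open>f\<close> with g_x and g_y, and the two conformality relations.\<close>

lemma g_laplace_products:
  fixes z
  defines "\<Delta> \<equiv> pdx (pdx g) z + pdy (pdy g) z"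
  assumes "z \<in> S"
  shows "\<Delta> \<bullet> g z = - (pdx g z \<bullet> pdx g z + pdy g z \<bullet> pdy g z)"
    "\<Delta> \<bullet> f z = 0" "\<Delta> \<bullet> pdx g z = 0" "\<Delta> \<bullet> pdy g z = 0"
proof -
  note z = \<open>z \<in> S\<close>
  note D = differentiable_jet [OF z]
  note comm = pd_commute [OF S z g]
  show "\<Delta> \<bullet> g z = - (pdx g z \<bullet> pdx g z + pdy g z \<bullet> pdy g z)"
    using pd_inner_const(1) [OF S z D(4,5) g_orthogonal(1)] pd_inner_const(2) [OF S z D(4,6) g_orthogonal(2)]
    by (simp add: \<Delta>_def inner_add_left inner_commute [of "g z"])
  show "\<Delta> \<bullet> f z = 0"
    using pd_inner_const(1) [OF S z D(5,1) first_derivative_products(1)]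
      pd_inner_const(2) [OF S z D(6,1) first_derivative_products(2)] first_derivative_products(3) [OF z]
    by (simp add: \<Delta>_def inner_add_left)
  have xy: "pdx (pdx g) z \<bullet> pdy g z + pdx g z \<bullet> pdx (pdy g) z = 0"
    "pdy (pdx g) z \<bullet> pdy g z + pdx g z \<bullet> pdy (pdy g) z = 0"
    by (rule pd_inner_const [OF S z D(5,6) g_conformality(2)]; assumption)+
  \<comment> \<open>The factorization |g_y|^2 - |g_x|^2 = (g_y + g_x).(g_y - g_x) turns the length
    relation into one constant inner product, so that \<open>pd_inner_const\<close> applies.\<close>
  let ?u = "\<lambda>w. pdy g w + pdx g w" and ?v = "\<lambda>w. pdy g w + (- 1) *\<^sub>R pdx g w"
  have dm: "(\<lambda>w. (- 1) *\<^sub>R pdx g w) differentiable (at z)"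
    using D(5) by simp
  have uv: "?u w \<bullet> ?v w = 4" if "w \<in> S" for w
    using g_conformality [OF that] by (simp add: inner_simps inner_commute)
  have "?u differentiable (at z)" "?v differentiable (at z)" using D by simp_all
  from pd_inner_const [OF S z this uv]
  have "pdy (pdy g) z \<bullet> pdy g z = pdy (pdx g) z \<bullet> pdx g z"
    "pdx (pdy g) z \<bullet> pdy g z = pdx (pdx g) z \<bullet> pdx g z"
    unfolding pd_add [OF D(6,5)] pd_add [OF D(6) dm] pd_linear [OF bounded_linear_scaleR_right D(5)]
    by (simp_all add: inner_simps inner_commute)
  with xy show "\<Delta> \<bullet> pdx g z = 0" "\<Delta> \<bullet> pdy g z = 0"
    by (simp_all add: \<Delta>_def inner_simps comm inner_commute)
qed

text \<open>When g_x is nonzero, f, g, g_x and k = g_y + 2\<sigma>f form an orthogonal basis,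
  because |k| = |g_x|. The defect of the harmonic map equation is orthogonal to all four.\<close>

lemma g_harmonic_equation_nondegenerate:
  assumes "z \<in> S" "pdx g z \<noteq> 0"
  shows "pdx (pdx g) z + pdy (pdy g) z = - (pdx g z \<bullet> pdx g z + pdy g z \<bullet> pdy g z) *\<^sub>R g z"
proof -
  note z = \<open>z \<in> S\<close>
  let ?\<Delta> = "pdx (pdx g) z + pdy (pdy g) z"
  let ?e = "pdx g z \<bullet> pdx g z + pdy g z \<bullet> pdy g z"
  define k where "k = pdy g z + (2 * \<sigma>) *\<^sub>R f z"
  note facts = g_laplace_products [OF z] first_derivative_products [OF z] g_conformality [OF z]
    ff [OF z] gf [OF z] gg [OF z] g_orthogonal [OF z]
  have "k \<bullet> f z = 0" "k \<bullet> g z = 0" "pdx g z \<bullet> k = 0"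
    using facts by (simp_all add: k_def inner_simps inner_commute)
  moreover have "k \<bullet> k = pdx g z \<bullet> pdx g z"
    using facts \<sigma> by (simp add: k_def inner_simps inner_commute algebra_simps)
  then have "k \<noteq> 0" using assms(2) by auto
  moreover have "f z \<noteq> 0" "g z \<noteq> 0" using facts by auto
  moreover have "(?\<Delta> + ?e *\<^sub>R g z) \<bullet> k = 0" "(?\<Delta> + ?e *\<^sub>R g z) \<bullet> g z = 0"
    "(?\<Delta> + ?e *\<^sub>R g z) \<bullet> f z = 0" "(?\<Delta> + ?e *\<^sub>R g z) \<bullet> pdx g z = 0"
    unfolding inner_add_left [of ?\<Delta>] using facts by (simp_all add: k_def inner_add_right)
  ultimately have "?\<Delta> + ?e *\<^sub>R g z = 0"
    using facts by (intro orthogonal_to_basis_4 [of "f z" "g z" "pdx g z" k]) (simp_all add: assms inner_commute)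
  then show ?thesis by (simp only: scaleR_minus_left eq_neg_iff_add_eq_0)
qed

text \<open>Where \<open>g\<^sub>x = 0\<close>, equality in the Cauchy--Schwarz inequality gives \<open>f = -\<sigma>g\<^sub>y/2\<close>; if this
  happened on an open set, then \<open>f\<^sub>x = -\<sigma>g\<^sub>x\<^sub>y/2\<close> would vanish there.\<close>

lemma g_nondegenerate_dense:
  assumes "open U" "U \<subseteq> S" "z \<in> U"
  shows "\<exists>w\<in>U. pdx g w \<noteq> 0"
proof (rule ccontr)
  assume "\<not> ?thesis"
  then have 0: "pdx g w = 0" if "w \<in> U" for w using that by blast
  have "z \<in> S" using assms by blast
  have "f w = (- \<sigma> / 2) *\<^sub>R pdy g w" if "w \<in> U" for w
  proof -
    have "w \<in> S" using that assms by blast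
    define k where "k = pdy g w + (2 * \<sigma>) *\<^sub>R f w"
    \<comment> \<open>The equality case appears as a vanishing square: |k|^2 = |g_y|^2 - 4 =
      |g_x|^2.\<close>
    have "k \<bullet> k = 0"
      using first_derivative_products [OF \<open>w \<in> S\<close>] g_conformality [OF \<open>w \<in> S\<close>] ff [OF \<open>w \<in> S\<close>] \<sigma> 0 [OF that]
      by (simp add: k_def inner_simps inner_commute algebra_simps)
    then have "pdy g w = (- (2 * \<sigma>)) *\<^sub>R f w" by (simp add: k_def eq_neg_iff_add_eq_0)
    then show ?thesis using \<sigma> by simp
  qed
  then have "pdx f z = pdx (\<lambda>w. (- \<sigma> / 2) *\<^sub>R pdy g w) z"
    by (rule pd_cong_open [OF assms(1,3)])
  also have "\<dots> = (- \<sigma> / 2) *\<^sub>R pdy (pdx g) z"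
    using pd_linear(1) [OF bounded_linear_scaleR_right differentiable_jet(6) [OF \<open>z \<in> S\<close>], of "- \<sigma> / 2"] pd_commute [OF S \<open>z \<in> S\<close> g]
    by simp
  also have "pdy (pdx g) z = 0"
    using pd_cong_open(2) [OF assms(1,3), of "pdx g" "\<lambda>w. 0"] 0 by simp
  finally show False using f(3) [OF \<open>z \<in> S\<close>] by simp
qed

lemma g_harmonic_equation:
  assumes "z \<in> S"
  shows "pdx (pdx g) z + pdy (pdy g) z = - (pdx g z \<bullet> pdx g z + pdy g z \<bullet> pdy g z) *\<^sub>R g z"
proof (rule ccontr)
  let ?F = "\<lambda>z. pdx (pdx g) z + pdy (pdy g) z + (pdx g z \<bullet> pdx g z + pdy g z \<bullet> pdy g z) *\<^sub>R g z"
  assume "\<not> ?thesis"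
  then have "?F z \<noteq> 0" by (simp only: scaleR_minus_left eq_neg_iff_add_eq_0 not_False_eq_True)
  have "continuous_on S ?F"
    using smooth_map_onD [OF g] smooth_map_onD by (intro continuous_intros) blast+
  \<comment> \<open>A nonzero defect would persist on an open set, and by density that set contains
    a point with g_x nonzero.\<close>
  then have "open (S \<inter> ?F -` (- {0}))"
    by (intro continuous_open_preimage S) auto
  moreover have "z \<in> S \<inter> ?F -` (- {0})" using assms \<open>?F z \<noteq> 0\<close> by simp
  ultimately obtain w where w: "w \<in> S" "?F w \<noteq> 0" "pdx g w \<noteq> 0"
    using g_nondegenerate_dense [of "S \<inter> ?F -` (- {0})" z] by auto
  from g_harmonic_equation_nondegenerate [OF w(1,3)] w(2) show False
    by (simp only: scaleR_minus_left left_minus not_True_eq_False simp_thms)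
qed

lemma g_harmonic: "harmonic_map_S3 S g"
  using g g_harmonic_equation harmonic_equation_iff [OF S _ g] gg
  by (auto simp: harmonic_map_S3_def norm_eq_1)

lemma g_non_conformal: "non_conformal S g"
  using g_adapted by (simp add: adapted_coordinate_def non_conformal_def)

end

section \<open>The transforms\<close>

lemma bounded_bilinear_qmul: "bounded_bilinear (\<odot>)"
  unfolding bilinear_conv_bounded_bilinear [symmetric] bilinear_def
  by (intro conjI allI linearI; simp add: qmul_def vec_eq_iff forall_4 algebra_simps)

text \<open>Quaternion conjugation, the inverse on unit quaternions; it recovers
  \<open>im (beta f z)\<close> smoothly from f and f_y.\<close>

definition qconj :: "real^4 \<Rightarrow> real^4"
  where "qconj p = vector [p$1, - p$2, - p$3, - p$4]"

lemma bounded_linear_qconj: "bounded_linear qconj"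
  by (rule linear_conv_bounded_linear [THEN iffD1])
    (intro linearI; simp add: qconj_def vec_eq_iff forall_4)

lemma qconj_qmul: "norm p = 1 \<Longrightarrow> qconj p \<odot> p = axis 1 1"
  by (simp add: norm_eq_1 inner_vec_def sum_4 qconj_def qmul_def vec_eq_iff forall_4 axis_def algebra_simps)

text \<open>The scalar part of a product of imaginary quaternions is minus their inner product, so
  orthogonality leaves the vector product.\<close>

lemma im_qmul_im: "v \<bullet> w = 0 \<Longrightarrow> im v \<odot> im w = im (v \<times> w)"
  by (simp add: inner_vec_def sum_3 im_def qmul_def vec_eq_iff forall_4 cross3_def algebra_simps)

lemma inner_qmul_im: "(p \<odot> im v) \<bullet> p = 0"
  by (simp add: im_def qmul_def inner_vec_def sum_4 algebra_simps)

lemma im_linear: "im (v + w) = im v + im w" "im (c *\<^sub>R v) = c *\<^sub>R im v"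
  by (simp_all add: im_def vec_eq_iff forall_4)

definition transform :: "real \<Rightarrow> (complex \<Rightarrow> real^4) \<Rightarrow> complex \<Rightarrow> real^4"
  where "transform \<sigma> f z = (1 / (2 * (cosh (phi f z))\<^sup>2)) *\<^sub>R
      (f z \<odot> im (\<sigma> *\<^sub>R beta f z + (1/2) *\<^sub>R (alpha f z \<times> beta f z)))"

text \<open>Left multiplication by the unit quaternion f is an isometry, so the products reduce to
  those of the pairwise orthogonal vectors \<alpha>, \<beta> and \<alpha> \<times> \<beta>.\<close>

lemma transform_pair_transform:
  assumes S: "open S" and f: "harmonic_map_S3 S f" "adapted_coordinate S f"
    and \<alpha>: "\<forall>z\<in>S. alpha f z \<noteq> 0" and \<sigma>: "\<sigma> * \<sigma> = 1"
  shows "transform_pair S f (transform \<sigma> f) \<sigma>"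
proof -
  have sm: "smooth_map_on S f" using f by (simp add: harmonic_map_S3_def)
  have n: "norm (f z) = 1" if "z \<in> S" for z
    using f that by (auto simp: harmonic_map_S3_def)
  \<comment> \<open>As |\<beta>|^2 = 4 cosh^2 \<phi>, the coefficient of the transform is 2/b, which
    removes \<open>phi\<close>.\<close>
  define b where "b z = beta f z \<bullet> beta f z" for z
  define u where "u z = (2 / b z) *\<^sub>R (\<sigma> *\<^sub>R beta f z + (1/2) *\<^sub>R (alpha f z \<times> beta f z))" for z
  have x: "pdx f z = f z \<odot> im (alpha f z)" and y: "pdy f z = f z \<odot> im (beta f z)"
    and ab: "alpha f z \<bullet> beta f z = 0" and bb: "b z = alpha f z \<bullet> alpha f z + 4" and b0: "b z > 0"
    and tr: "transform \<sigma> f z = f z \<odot> im (u z)" if "z \<in> S" for z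
  proof -
    show "pdx f z = f z \<odot> im (alpha f z)" "pdy f z = f z \<odot> im (beta f z)"
      using alpha_works beta_works S f that by blast+
    show "alpha f z \<bullet> beta f z = 0" and bb: "b z = alpha f z \<bullet> alpha f z + 4"
      using alpha_beta_adapted [OF S that f] by (simp_all add: b_def power2_norm_eq_inner)
    then show "b z > 0" using inner_ge_zero [of "alpha f z"] by linarith
    have "b z = 4 * (cosh (phi f z))\<^sup>2"
      using phi_works(3) [OF S that f] by (simp add: b_def dot_square_norm power_mult_distrib)
    then show "transform \<sigma> f z = f z \<odot> im (u z)"
      by (simp add: transform_def u_def im_linear bounded_bilinear.scaleR_right [OF bounded_bilinear_qmul])
  qed
  have inn: "(f z \<odot> im v) \<bullet> (f z \<odot> im w) = v \<bullet> w" if "z \<in> S" for z v w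
    by (simp add: inner_qmul_left n [OF that])
  have cr: "(v \<times> w) \<bullet> v = 0" "(v \<times> w) \<bullet> w = 0" for v w
    by (simp_all add: dot_cross_self)
  show ?thesis
  proof
    show "open S" "harmonic_map_S3 S f" "adapted_coordinate S f" "\<sigma> * \<sigma> = 1" by fact+
    show "pdx f z \<noteq> 0" if "z \<in> S" for z
    proof
      assume "pdx f z = 0"
      then have "alpha f z \<bullet> alpha f z = 0" using inn [OF that] x [OF that] by (metis inner_zero_left)
      then show False using \<alpha> that by simp
    qed
    show "transform \<sigma> f z \<bullet> f z = 0" if "z \<in> S" for z
      by (simp add: tr [OF that] inner_qmul_im)
    show "transform \<sigma> f z \<bullet> pdx f z = 0" if "z \<in> S" for z
      using ab [OF that] cr by (simp add: tr x inn that u_def inner_simps inner_commute)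
    show "transform \<sigma> f z \<bullet> pdy f z = 2 * \<sigma>" if "z \<in> S" for z
      using b0 [OF that] cr by (simp add: tr y inn that u_def inner_simps b_def [symmetric])
    show "transform \<sigma> f z \<bullet> transform \<sigma> f z = 1" if "z \<in> S" for z
    proof -
      let ?c = "alpha f z \<times> beta f z" and ?a = "alpha f z \<bullet> alpha f z"
      \<comment> \<open>Lagrange's identity with \<alpha> and \<beta> orthogonal.\<close>
      have c: "?c \<bullet> ?c = ?a * b z"
        using ab [OF that] by (simp add: dot_cross b_def inner_commute)
      have "u z \<bullet> u z = (2 / b z)\<^sup>2 * ((\<sigma> * \<sigma>) * b z + (1/4) * (?a * b z))"
        using c cr by (simp add: u_def inner_simps b_def [symmetric] power2_eq_square algebra_simps inner_commute)
      \<comment> \<open>The first quotient is 1; the second is 1 because b = |\<alpha>|^2 +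
        4.\<close>
      also have "\<dots> = (4 * (b z * b z)) / (4 * (b z * b z)) * ((4 + ?a) / b z)"
        using b0 [OF that] \<sigma> by (simp add: field_simps power2_eq_square)
      also have "\<dots> = 1" using b0 [OF that] bb [OF that] by simp
      finally show ?thesis by (simp add: tr inn that)
    qed
    show "smooth_map_on S (transform \<sigma> f)"
      unfolding smooth_map_on_def
    proof
      fix k
      have "ck_on k S f" "ck_on k S (pdx f)" "ck_on k S (pdy f)"
        using smooth_map_onD [OF sm] sm by (auto simp: smooth_map_on_def)
      moreover have "pdy f z \<bullet> pdy f z \<noteq> 0" if "z \<in> S" for z
        using b0 [OF that] by (simp add: y inn that b_def)
      \<comment> \<open>A formula for the transform in f, f_x and f_y alone: f_x times the product
        of conjugate f with f_y is f\<alpha>\<beta> = f(\<alpha> \<times> \<beta>), and b =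
        |f_y|^2.\<close>
      ultimately have "ck_on k S (\<lambda>z. inverse (pdy f z \<bullet> pdy f z) *\<^sub>R
          ((2 * \<sigma>) *\<^sub>R pdy f z + pdx f z \<odot> (qconj (f z) \<odot> pdy f z)))"
        by (intro ck_on_bilinear [OF S bounded_bilinear_scaleR] ck_on_bilinear [OF S bounded_bilinear_qmul]
            ck_on_bilinear [OF S bounded_bilinear_inner] ck_on_inverse [OF S] ck_on_add [OF S]
            ck_on_linear [OF S bounded_linear_qconj] ck_on_linear [OF S bounded_linear_scaleR_right])
      moreover have "inverse (pdy f z \<bullet> pdy f z) *\<^sub>R
          ((2 * \<sigma>) *\<^sub>R pdy f z + pdx f z \<odot> (qconj (f z) \<odot> pdy f z)) = transform \<sigma> f z"
        if "z \<in> S" for z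
      proof -
        have "qconj (f z) \<odot> pdy f z = im (beta f z)"
          by (simp add: y that qmul_assoc [symmetric] qconj_qmul n hamilton_relations)
        then have "pdx f z \<odot> (qconj (f z) \<odot> pdy f z) = f z \<odot> im (alpha f z \<times> beta f z)"
          by (simp add: x that qmul_assoc im_qmul_im ab)
        moreover have "pdy f z \<bullet> pdy f z = b z" by (simp add: y that inn b_def)
        moreover have "transform \<sigma> f z =
            (2 / b z) *\<^sub>R (\<sigma> *\<^sub>R pdy f z + (1/2) *\<^sub>R (f z \<odot> im (alpha f z \<times> beta f z)))"
          by (simp only: tr [OF that] y [OF that] u_def im_linear bounded_bilinear.scaleR_right [OF bounded_bilinear_qmul]
              bounded_bilinear.add_right [OF bounded_bilinear_qmul])
        ultimately show ?thesis
          by (simp only:) (simp add: scaleR_add_right inverse_eq_divide)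
      qed
      ultimately show "ck_on k S (transform \<sigma> f)"
        by (rule ck_on_cong [OF S, THEN iffD1, rotated])
    qed
  qed
qed

theorem theorem3p2:
  fixes S :: "complex set" and f :: "complex \<Rightarrow> real^4"
  assumes "open S"
    and "harmonic_map_S3 S f" and "non_conformal S f"
    and "adapted_coordinate S f"
    and "\<forall>z\<in>S. alpha f z \<noteq> 0"
  shows "harmonic_map_S3 S (plus_transform f) \<and> non_conformal S (plus_transform f) \<and>
         adapted_coordinate S (plus_transform f) \<and>
         harmonic_map_S3 S (minus_transform f) \<and> non_conformal S (minus_transform f) \<and>
         adapted_coordinate S (minus_transform f)"
proof -
  have "plus_transform f = transform 1 f" "minus_transform f = transform (- 1) f"
    by (auto simp: plus_transform_def minus_transform_def transform_def)
  moreover have "transform_pair S f (transform 1 f) 1" "transform_pair S f (transform (- 1) f) (- 1)"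
    using assms by (auto intro: transform_pair_transform)
  ultimately show ?thesis
    by (simp add: transform_pair.g_harmonic transform_pair.g_non_conformal transform_pair.g_adapted)
qed

end
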